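(* Let $X$ be a finite alphabet, let $L$ be a Mealy machine with input and output alphabet $X$ and states $g_0,\dots,g_{n-1}$, transition function $\pi$ and output function $\lambda$, and let $\nu$ be the Bernoulli measure on $X^{\mathbb N}$ given by a probability vector $(p(x))_{x\in X}$. For $v=(a_0,\dots,a_{n-1})\in\mathbb R^n$ such that $\mu_v:=\sum_{i=0}^{n-1}a_i\,(g_i)_*\nu$ is a probability measure, $\mu_v$ is finite-state if and only if the orbit of $v$ under the action of the semigroup generated by the maps $\phi_x$, $x\in X$, is finite, where $$\phi_x(u)=\frac{M_xu}{p_x\cdot u},\qquad M_x(i,j)=\sum_{y\in X:\ \pi(g_j,y)=g_i,\ \lambda(g_j,y)=x}p(y),\qquad p_x(j)=\sum_{i=0}^{n-1}M_x(i,j)$$ (with $\phi_x(u)=0$ when $p_x\cdot u=0$). The graph of this action on the orbit of $v$ (edges $u\to\phi_x(u)$ labelled by $x$) is the transition diagram of the automaton that computes $\mu_v$.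
   Context: Each state $g_i$ of $L$ acts on infinite words by $g_i(yw)=\lambda(g_i,y)\,\pi(g_i,y)(w)$ for $y\in X$. The pushforward is $g_*\nu(E)=\nu(g^{-1}(E))$. The Bernoulli measure satisfies $\nu(wX^{\mathbb N})=\prod_i p(w_i)$, where $wX^{\mathbb N}$ is the cylinder of infinite words with prefix $w$. For a probability measure $\mu$ on $X^{\mathbb N}$ and a finite word $w$, the section $\mu|_w$ is the probability measure with $\mu|_w(vX^{\mathbb N})=\mu(wvX^{\mathbb N})/\mu(wX^{\mathbb N})$ if $\mu(wX^{\mathbb N})\ne0$, and the null measure otherwise; sections of the null measure are null. $\mu$ is finite-state if it has only finitely many distinct sections. An automaton with real outputs computes a probability measure $\mu$ if each state $s$ represents a section of $\mu$, the initial state represents $\mu$, and when $s$ represents $\rho$, the transition on $x\in X$ leads to a state representing $\rho|_x$ with output $\rho(xX^{\mathbb N})$; then $\mu(wX^{\mathbb N})$ is the product of the outputs along $w$. Here the vertex $u$ of the orbit represents $\mu_u=\sum_i u_i(g_i)_*\nu$. The orbit of $v$ includes $v$.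
   Formalization: "Finite-state implies finite orbit" fails when distinct vectors represent one measure; the theorem proves the equivalence with orbit vectors u, u' identified when μ_u = μ_u', and literally if the (g_i)_*ν are linearly independent; the other claims are literal. *)

theory Defs
  imports "HOL-Probability.Probability"
begin

section \<open>Infinite words and sections of measures\<close>

abbreviation words :: "'x stream measure" where
  "words \<equiv> stream_space (count_space UNIV)"

abbreviation cylinder :: "'x list \<Rightarrow> 'x stream set" where
  "cylinder w \<equiv> sstart UNIV w"

definition is_section :: "'x stream measure \<Rightarrow> 'x list \<Rightarrow> 'x stream measure \<Rightarrow> bool" where
  "is_section \<mu> w \<rho> \<longleftrightarrow>
     (if measure \<mu> (cylinder w) \<noteq> 0
      then sets \<rho> = sets words \<and> prob_space \<rho> \<and>
           (\<forall>u. measure \<rho> (cylinder u) = measure \<mu> (cylinder (w @ u)) / measure \<mu> (cylinder w))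
      else \<rho> = null_measure words)"

text \<open>For a probability measure or the null measure on infinite words over a countable alphabet
  there is exactly one such measure, see \<open>is_section_msection\<close> and \<open>is_section_unique\<close> below.\<close>

definition msection :: "'x stream measure \<Rightarrow> 'x list \<Rightarrow> 'x stream measure" where
  "msection \<mu> w = (THE \<rho>. is_section \<mu> w \<rho>)"

definition finite_state :: "'x stream measure \<Rightarrow> bool" where
  "finite_state \<mu> \<longleftrightarrow> finite (range (msection \<mu>))"


section \<open>Automata with real outputs\<close>

record ('s, 'x) real_automaton =
  states :: "'s set"
  initial :: 's
  trans :: "'s \<Rightarrow> 'x \<Rightarrow> 's"
  weight :: "'s \<Rightarrow> 'x \<Rightarrow> real"

definition transition_diagram :: "('s, 'x) real_automaton \<Rightarrow> ('s \<times> 'x \<times> 's) set" where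
  "transition_diagram A = {(s, x, trans A s x) | s x. s \<in> states A}"

text \<open>\<open>R s \<rho>\<close> says that the state \<open>s\<close> represents the measure \<open>\<rho>\<close>.\<close>

definition computes ::
    "('s, 'x) real_automaton \<Rightarrow> ('s \<Rightarrow> 'x stream measure \<Rightarrow> bool) \<Rightarrow> 'x stream measure \<Rightarrow> bool" where
  "computes A R \<mu> \<longleftrightarrow>
     initial A \<in> states A \<and>
     (\<forall>s\<in>states A. \<forall>x. trans A s x \<in> states A) \<and>
     R (initial A) \<mu> \<and>
     (\<forall>s\<in>states A. \<exists>w. R s (msection \<mu> w)) \<and>
     (\<forall>s\<in>states A. \<forall>\<rho> x. R s \<rho> \<longrightarrow>
        R (trans A s x) (msection \<rho> [x]) \<and> weight A s x = measure \<rho> (cylinder [x]))"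


section \<open>Mealy machines acting on Bernoulli measures\<close>

text \<open>A Mealy machine over the alphabet \<open>'x\<close> is given by its transition function
  \<open>\<pi> :: 'n \<Rightarrow> 'x \<Rightarrow> 'n\<close> and its output function \<open>out :: 'n \<Rightarrow> 'x \<Rightarrow> 'x\<close>; the finite type \<open>'n\<close>
  indexes the states, and the probability vector is a \<open>pmf\<close>.\<close>

primcorec act :: "('n \<Rightarrow> 'x \<Rightarrow> 'n) \<Rightarrow> ('n \<Rightarrow> 'x \<Rightarrow> 'x) \<Rightarrow> 'n \<Rightarrow> 'x stream \<Rightarrow> 'x stream" where
  "shd (act \<pi> out g w) = out g (shd w)"
| "stl (act \<pi> out g w) = act \<pi> out (\<pi> g (shd w)) (stl w)"

definition bernoulli :: "'x pmf \<Rightarrow> 'x stream measure" where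
  "bernoulli p = stream_space (measure_pmf p)"

definition pushforward ::
    "('n \<Rightarrow> 'x \<Rightarrow> 'n) \<Rightarrow> ('n \<Rightarrow> 'x \<Rightarrow> 'x) \<Rightarrow> 'x pmf \<Rightarrow> 'n \<Rightarrow> 'x stream measure" where
  "pushforward \<pi> out p g = distr (bernoulli p) words (act \<pi> out g)"

text \<open>The signed measure \<open>\<mu>\<^sub>u\<close>, as a set function on the measurable sets.\<close>

definition comb :: "('n::finite \<Rightarrow> 'x \<Rightarrow> 'n) \<Rightarrow> ('n \<Rightarrow> 'x \<Rightarrow> 'x) \<Rightarrow> 'x pmf \<Rightarrow>
    real ^ 'n \<Rightarrow> 'x stream set \<Rightarrow> real" where
  "comb \<pi> out p u E = (\<Sum>i\<in>UNIV. u $ i * measure (pushforward \<pi> out p i) E)"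

text \<open>Finiteness of \<open>\<rho>\<close> is required because \<open>measure\<close> sends infinite values to \<open>0\<close>.\<close>

definition represents :: "('n::finite \<Rightarrow> 'x \<Rightarrow> 'n) \<Rightarrow> ('n \<Rightarrow> 'x \<Rightarrow> 'x) \<Rightarrow> 'x pmf \<Rightarrow>
    real ^ 'n \<Rightarrow> 'x stream measure \<Rightarrow> bool" where
  "represents \<pi> out p u \<rho> \<longleftrightarrow> sets \<rho> = sets words \<and> finite_measure \<rho> \<and>
     (\<forall>E\<in>sets words. measure \<rho> E = comb \<pi> out p u E)"

text \<open>Distinct vectors represent the same measure as soon as the measures \<open>(g\<^sub>i)\<^sub>*\<nu>\<close> are linearly
  dependent, and an orbit of vectors may then be infinite although \<open>\<mu>\<^sub>v\<close> is finite-state.  Example: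
  alphabet \<open>{a, b}\<close> with uniform \<open>p\<close>, two states that always output \<open>a\<close>, where \<open>g\<^sub>0\<close> stays at
  \<open>g\<^sub>0\<close> on \<open>a\<close> and moves to the absorbing state \<open>g\<^sub>1\<close> on \<open>b\<close>.  Both pushforwards are the point
  mass at \<open>aaa\<dots>\<close>, but the orbit of \<open>(1, 0)\<close> contains \<open>(2\<^sup>-\<^sup>k, 1 - 2\<^sup>-\<^sup>k)\<close> for all \<open>k\<close>.  Hence a
  vertex \<open>u\<close> has to be identified with the measure \<open>\<mu>\<^sub>u\<close> that it represents, unless the
  pushforwards are linearly independent.\<close>

definition same_measure :: "('n::finite \<Rightarrow> 'x \<Rightarrow> 'n) \<Rightarrow> ('n \<Rightarrow> 'x \<Rightarrow> 'x) \<Rightarrow> 'x pmf \<Rightarrow>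
    (real ^ 'n) rel" where
  "same_measure \<pi> out p =
     {(u, u'). \<forall>E\<in>sets words. comb \<pi> out p u E = comb \<pi> out p u' E}"

definition independent_pushforwards ::
    "('n::finite \<Rightarrow> 'x \<Rightarrow> 'n) \<Rightarrow> ('n \<Rightarrow> 'x \<Rightarrow> 'x) \<Rightarrow> 'x pmf \<Rightarrow> bool" where
  "independent_pushforwards \<pi> out p \<longleftrightarrow>
     (\<forall>c. (\<forall>E\<in>sets words. comb \<pi> out p c E = 0) \<longrightarrow> c = 0)"

definition transfer_matrix :: "('n::finite \<Rightarrow> 'x::finite \<Rightarrow> 'n) \<Rightarrow> ('n \<Rightarrow> 'x \<Rightarrow> 'x) \<Rightarrow> 'x pmf \<Rightarrow>
    'x \<Rightarrow> real ^ 'n ^ 'n" where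
  "transfer_matrix \<pi> out p x = (\<chi> i j. \<Sum>y | \<pi> j y = i \<and> out j y = x. pmf p y)"

definition column_sums :: "('n::finite \<Rightarrow> 'x::finite \<Rightarrow> 'n) \<Rightarrow> ('n \<Rightarrow> 'x \<Rightarrow> 'x) \<Rightarrow> 'x pmf \<Rightarrow>
    'x \<Rightarrow> real ^ 'n" where
  "column_sums \<pi> out p x = (\<chi> j. \<Sum>i\<in>UNIV. transfer_matrix \<pi> out p x $ i $ j)"

definition phi :: "('n::finite \<Rightarrow> 'x::finite \<Rightarrow> 'n) \<Rightarrow> ('n \<Rightarrow> 'x \<Rightarrow> 'x) \<Rightarrow> 'x pmf \<Rightarrow>
    'x \<Rightarrow> real ^ 'n \<Rightarrow> real ^ 'n" where
  "phi \<pi> out p x u =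
     (if column_sums \<pi> out p x \<bullet> u = 0 then 0
      else (1 / (column_sums \<pi> out p x \<bullet> u)) *\<^sub>R (transfer_matrix \<pi> out p x *v u))"

inductive_set generated_semigroup :: "('a \<Rightarrow> 'a) set \<Rightarrow> ('a \<Rightarrow> 'a) set" for F where
  generator: "f \<in> F \<Longrightarrow> f \<in> generated_semigroup F"
| comp: "f \<in> generated_semigroup F \<Longrightarrow> g \<in> generated_semigroup F \<Longrightarrow> f \<circ> g \<in> generated_semigroup F"

definition phi_orbit :: "('n::finite \<Rightarrow> 'x::finite \<Rightarrow> 'n) \<Rightarrow> ('n \<Rightarrow> 'x \<Rightarrow> 'x) \<Rightarrow> 'x pmf \<Rightarrow>
    real ^ 'n \<Rightarrow> (real ^ 'n) set" where
  "phi_orbit \<pi> out p v = insert v {f v | f. f \<in> generated_semigroup (range (phi \<pi> out p))}"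

definition action_graph :: "('n::finite \<Rightarrow> 'x::finite \<Rightarrow> 'n) \<Rightarrow> ('n \<Rightarrow> 'x \<Rightarrow> 'x) \<Rightarrow> 'x pmf \<Rightarrow>
    real ^ 'n \<Rightarrow> ((real ^ 'n) \<times> 'x \<times> (real ^ 'n)) set" where
  "action_graph \<pi> out p v = {(u, x, phi \<pi> out p x u) | u x. u \<in> phi_orbit \<pi> out p v}"

section \<open>Sanity checks\<close>

lemma is_section_unique:
  fixes \<mu> :: "'x::countable stream measure"
  assumes "is_section \<mu> w \<rho>" "is_section \<mu> w \<rho>'"
  shows "\<rho> = \<rho>'"
proof (cases "measure \<mu> (cylinder w) = 0")
  case True
  then show ?thesis using assms by (simp add: is_section_def)
next
  case False
  then have 1: "sets \<rho> = sets words" "prob_space \<rho>" "sets \<rho>' = sets words" "prob_space \<rho>'"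
    and 2: "\<And>u. measure \<rho> (cylinder u) = measure \<rho>' (cylinder u)"
    using assms by (auto simp: is_section_def)
  interpret a: prob_space \<rho> by fact
  interpret b: prob_space \<rho>' by fact
  show ?thesis
    using 1 2 by (intro stream_space_eq_sstart[of UNIV]) (auto simp: a.emeasure_eq_measure b.emeasure_eq_measure)
qed

lemma cylinder_append: "s \<in> cylinder (w @ u) \<longleftrightarrow> s \<in> cylinder w \<and> sdrop (length w) s \<in> cylinder u"
  by (induction w arbitrary: s) auto

lemma explicit_section:
  fixes \<mu> :: "'x::countable stream measure"
  assumes [measurable_cong]: "sets \<mu> = sets words" and "finite_measure \<mu>" and nz: "measure \<mu> (cylinder w) \<noteq> 0"
  defines "\<rho> \<equiv> distr (uniform_measure \<mu> (cylinder w)) words (sdrop (length w))"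
  shows "is_section \<mu> w \<rho>"
    and "E \<in> sets words \<Longrightarrow>
      measure \<rho> E = measure \<mu> {s \<in> cylinder w. sdrop (length w) s \<in> E} / measure \<mu> (cylinder w)"
proof -
  interpret finite_measure \<mu> by fact
  have sp: "space \<mu> = UNIV" using sets_eq_imp_space_eq[OF assms(1)] by (simp add: space_stream_space)
  have c[measurable]: "cylinder w \<in> sets \<mu>" using assms(1) sstart_sets by blast
  have p: "prob_space (uniform_measure \<mu> (cylinder w))"
    using nz by (intro prob_space_uniform_measure) (auto simp: measure_def)
  have m: "sdrop (length w) \<in> uniform_measure \<mu> (cylinder w) \<rightarrow>\<^sub>M words" by measurable
  have *: "measure \<rho> E = measure \<mu> {s \<in> cylinder w. sdrop (length w) s \<in> E} / measure \<mu> (cylinder w)"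
    if [measurable]: "E \<in> sets words" for E
  proof -
    have "measure \<rho> E = measure (uniform_measure \<mu> (cylinder w)) (sdrop (length w) -` E)"
      unfolding \<rho>_def using m by (simp add: measure_distr sp)
    also have "\<dots> = measure \<mu> (cylinder w \<inter> sdrop (length w) -` E) / measure \<mu> (cylinder w)"
    proof (rule measure_uniform_measure)
      have "sdrop (length w) -` E = {s\<in>space \<mu>. sdrop (length w) s \<in> E}" by (auto simp: sp)
      then show "sdrop (length w) -` E \<in> sets \<mu>" by simp
    qed (use nz in \<open>auto simp: measure_def\<close>)
    also have "cylinder w \<inter> sdrop (length w) -` E = {s \<in> cylinder w. sdrop (length w) s \<in> E}" by auto
    finally show ?thesis .
  qed
  then show "E \<in> sets words \<Longrightarrow>
      measure \<rho> E = measure \<mu> {s \<in> cylinder w. sdrop (length w) s \<in> E} / measure \<mu> (cylinder w)" .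
  have "prob_space \<rho>" unfolding \<rho>_def by (rule prob_space.prob_space_distr[OF p m])
  moreover have "{s \<in> cylinder w. sdrop (length w) s \<in> cylinder u} = cylinder (w @ u)" for u :: "'x list"
    by (auto simp: cylinder_append)
  ultimately show "is_section \<mu> w \<rho>"
    unfolding is_section_def using nz by (simp add: * sstart_sets) (simp add: \<rho>_def)
qed

lemma is_section_msection:
  fixes \<mu> :: "'x::countable stream measure"
  assumes "sets \<mu> = sets words" "finite_measure \<mu>"
  shows "is_section \<mu> w (msection \<mu> w)"
proof -
  have "\<exists>\<rho>. is_section \<mu> w \<rho>"
  proof (cases "measure \<mu> (cylinder w) = 0")
    case True
    then show ?thesis by (simp add: is_section_def)
  next
    case False
    from explicit_section(1)[OF assms this] show ?thesis by blast
  qed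
  then show ?thesis unfolding msection_def using is_section_unique by (metis theI)
qed

lemma bernoulli_cylinder:
  fixes p :: "'x::countable pmf"
  shows "measure (bernoulli p) (cylinder w) = prod_list (map (pmf p) w)"
proof -
  have "emeasure (stream_space (measure_pmf p)) (cylinder w) = ennreal (prod_list (map (pmf p) w))"
  proof (induction w)
    case Nil
    interpret prob_space "stream_space (measure_pmf p)"
      by (rule prob_space.prob_space_stream_space) (rule prob_space_measure_pmf)
    show ?case using emeasure_space_1 by (simp add: space_stream_space)
  next
    case (Cons x w)
    have s: "sets (stream_space (measure_pmf p)) = sets words" by (rule sets_stream_space_cong) simp
    have "emeasure (stream_space (measure_pmf p)) (cylinder (x # w))
        = (\<integral>\<^sup>+t. emeasure (stream_space (measure_pmf p)) (cylinder w) * indicator {x} t \<partial>measure_pmf p)"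
      by (subst prob_space.emeasure_stream_space[OF prob_space_measure_pmf])
         (auto simp: s sstart_sets space_stream_space indicator_def intro!: nn_integral_cong arg_cong2[where f=emeasure])
    also have "\<dots> = ennreal (prod_list (map (pmf p) w)) * ennreal (pmf p x)"
      by (subst nn_integral_cmult_indicator) (auto simp: Cons.IH emeasure_pmf_single)
    finally show ?case by (simp add: ennreal_mult' mult.commute prod_list_nonneg)
  qed
  moreover have "0 \<le> prod_list (map (pmf p) w)" by (induction w) auto
  ultimately show ?thesis
    by (simp add: bernoulli_def measure_def)
qed

lemma act_SCons: "act \<pi> out g (y ## w) = out g y ## act \<pi> out (\<pi> g y) w"
  by (simp add: stream.expand)

end

theory Submission
  imports Defs
begin

text \<open>Splitting off the first input letter of a Bernoulli word shows that the signed measure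
  \<open>\<mu>\<^sub>u\<close>, restricted to the words that start with \<open>x\<close> and shifted, is the signed measure of
  \<open>M\<^sub>x u\<close>, with total mass \<open>p\<^sub>x \<bullet> u\<close>.  Hence if \<open>u\<close> represents \<open>\<rho>\<close> then \<open>\<phi>\<^sub>x(u)\<close> represents
  \<open>\<rho>|\<^sub>x\<close>.  Since sections compose, the point of the orbit reached from \<open>v\<close> by reading \<open>w\<close>
  represents \<open>\<mu>|\<^sub>w\<close>, so two points of the orbit are identified exactly when the corresponding
  sections coincide.\<close>

section \<open>Measurability of the machine action and first-letter expansion of Bernoulli
  measures\<close>

lemma space_eq_UNIV_if_sets_words: "sets M = sets words \<Longrightarrow> space M = UNIV"
  using sets_eq_imp_space_eq[of M words] by (simp add: space_stream_space)

text \<open>Induction on the output position, for all states at once: letter \<open>Suc n\<close> of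
  the output is letter \<open>n\<close> of what the next state outputs on the tail, and the next
  state depends only on the first letter, which has countably many values.\<close>

lemma measurable_act [measurable]:
  fixes \<pi> :: "'n::finite \<Rightarrow> 'x::countable \<Rightarrow> 'n"
  shows "act \<pi> out g \<in> words \<rightarrow>\<^sub>M words"
proof (rule measurable_stream_space2)
  fix n show "(\<lambda>s. act \<pi> out g s !! n) \<in> words \<rightarrow>\<^sub>M count_space UNIV"
  proof (induction n arbitrary: g)
    case 0
    show ?case by simp
  next
    case (Suc n)
    note Suc.IH [measurable]
    have "(\<lambda>s. (\<lambda>x s. act \<pi> out (\<pi> g x) (stl s) !! n) (shd s) s) \<in> words \<rightarrow>\<^sub>M count_space UNIV"
      by (rule measurable_compose_countable) measurable
    then show ?case by simp
  qed
qed

lemma sets_bernoulli [simp, measurable_cong]: "sets (bernoulli p) = sets words"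
  unfolding bernoulli_def by (rule sets_stream_space_cong) simp

lemma space_bernoulli [simp]: "space (bernoulli p) = UNIV"
  by (simp add: space_eq_UNIV_if_sets_words)

lemma prob_space_bernoulli: "prob_space (bernoulli p)"
  unfolding bernoulli_def by (rule prob_space.prob_space_stream_space[OF prob_space_measure_pmf])

text \<open>The first letter is independent of the tail, which is again Bernoulli. As the alphabet
  is finite, the integral over that letter is a finite sum.\<close>

lemma measure_bernoulli:
  fixes p :: "'x::finite pmf"
  assumes "E \<in> sets words"
  shows "measure (bernoulli p) E = (\<Sum>y\<in>UNIV. pmf p y * measure (bernoulli p) {s. y ## s \<in> E})"
proof -
  have "ennreal (measure (bernoulli p) E)
      = (\<integral>\<^sup>+y. measure (bernoulli p) {s. y ## s \<in> E} \<partial>measure_pmf p)"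
    using prob_space.prob_stream_space[OF prob_space_measure_pmf, of p "\<lambda>s. s \<in> E"] assms
    by (simp flip: bernoulli_def)
  also have "\<dots> = (\<Sum>y\<in>UNIV. ennreal (measure (bernoulli p) {s. y ## s \<in> E}) * ennreal (pmf p y))"
    by (rule nn_integral_measure_pmf_support) auto
  also have "\<dots> = ennreal (\<Sum>y\<in>UNIV. pmf p y * measure (bernoulli p) {s. y ## s \<in> E})"
    by (simp add: mult.commute sum_nonneg flip: ennreal_mult')
  finally show ?thesis by (simp add: sum_nonneg)
qed

section \<open>Pushforwards and transfer matrices\<close>

lemma sets_pushforward [simp]: "sets (pushforward \<pi> out p g) = sets words"
  by (simp add: pushforward_def)

lemma measurable_bernoulli_act:
  fixes \<pi> :: "'n::finite \<Rightarrow> 'x::countable \<Rightarrow> 'n"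
  shows "act \<pi> out g \<in> bernoulli p \<rightarrow>\<^sub>M words"
  by measurable

lemma prob_space_pushforward:
  fixes \<pi> :: "'n::finite \<Rightarrow> 'x::countable \<Rightarrow> 'n"
  shows "prob_space (pushforward \<pi> out p g)"
  unfolding pushforward_def
  by (rule prob_space.prob_space_distr[OF prob_space_bernoulli measurable_bernoulli_act])

lemma measure_pushforward:
  fixes \<pi> :: "'n::finite \<Rightarrow> 'x::countable \<Rightarrow> 'n"
  assumes "E \<in> sets words"
  shows "measure (pushforward \<pi> out p g) E = measure (bernoulli p) (act \<pi> out g -` E)"
  unfolding pushforward_def using assms
  by (simp add: measure_distr[OF measurable_bernoulli_act])

lemma sets_shift_set [measurable]:
  assumes [measurable]: "E \<in> sets words"
  shows "{s. shd s = x \<and> stl s \<in> E} \<in> sets words"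
proof -
  have "{s \<in> space words. shd s = x \<and> stl s \<in> E} \<in> sets words" by measurable
  then show ?thesis by (simp add: space_stream_space)
qed

text \<open>Condition on the first input letter \<open>y\<close>: state \<open>j\<close> must output
  \<open>x\<close> on it, and the tail is then processed by \<open>\<pi> j y\<close>. Grouping these
  letters by the next state \<open>i\<close> collects their probabilities into column
  \<open>j\<close> of the matrix.\<close>

lemma measure_pushforward_shift_set:
  fixes \<pi> :: "'n::finite \<Rightarrow> 'x::finite \<Rightarrow> 'n"
  assumes E [measurable]: "E \<in> sets words"
  shows "measure (pushforward \<pi> out p j) {s. shd s = x \<and> stl s \<in> E}
    = (\<Sum>i\<in>UNIV. transfer_matrix \<pi> out p x $ i $ j * measure (pushforward \<pi> out p i) E)"
proof -
  let ?F = "{s. shd s = x \<and> stl s \<in> E}"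
  have "act \<pi> out j -` ?F \<inter> space words \<in> sets words"
    by (rule measurable_sets[OF measurable_act]) measurable
  then have F: "act \<pi> out j -` ?F \<in> sets words" by (simp add: space_stream_space)
  have "measure (pushforward \<pi> out p j) ?F
      = (\<Sum>y\<in>UNIV. pmf p y * measure (bernoulli p) {s. y ## s \<in> act \<pi> out j -` ?F})"
    by (simp only: measure_pushforward[OF sets_shift_set[OF E]] measure_bernoulli[OF F])
  also have "\<dots> = (\<Sum>y\<in>UNIV. if out j y = x
      then pmf p y * measure (pushforward \<pi> out p (\<pi> j y)) E else 0)"
    by (intro sum.cong) (auto simp: measure_pushforward act_SCons vimage_def)
  also have "\<dots> = (\<Sum>y | out j y = x. pmf p y * measure (pushforward \<pi> out p (\<pi> j y)) E)"
    by (simp add: sum.If_cases)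
  also have "\<dots> = (\<Sum>i\<in>UNIV. \<Sum>y | out j y = x \<and> \<pi> j y = i.
      pmf p y * measure (pushforward \<pi> out p (\<pi> j y)) E)"
    by (subst sum.group[symmetric, where g = "\<pi> j" and T = UNIV]) auto
  also have "\<dots> = (\<Sum>i\<in>UNIV. transfer_matrix \<pi> out p x $ i $ j * measure (pushforward \<pi> out p i) E)"
    by (intro sum.cong) (auto simp: transfer_matrix_def sum_distrib_right intro!: sum.cong)
  finally show ?thesis .
qed

lemma comb_shift_set:
  fixes \<pi> :: "'n::finite \<Rightarrow> 'x::finite \<Rightarrow> 'n"
  assumes "E \<in> sets words"
  shows "comb \<pi> out p u {s. shd s = x \<and> stl s \<in> E} = comb \<pi> out p (transfer_matrix \<pi> out p x *v u) E"
proof -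
  let ?m = "\<lambda>i. measure (pushforward \<pi> out p i) E" and ?M = "transfer_matrix \<pi> out p x"
  have "comb \<pi> out p u {s. shd s = x \<and> stl s \<in> E}
      = (\<Sum>j\<in>UNIV. \<Sum>i\<in>UNIV. ?M $ i $ j * u $ j * ?m i)"
    by (simp add: comb_def measure_pushforward_shift_set[OF assms] sum_distrib_left mult_ac)
  also have "\<dots> = (\<Sum>i\<in>UNIV. \<Sum>j\<in>UNIV. ?M $ i $ j * u $ j * ?m i)"
    by (rule sum.swap)
  also have "\<dots> = comb \<pi> out p (?M *v u) E"
    by (simp add: comb_def matrix_vector_mult_def sum_distrib_right)
  finally show ?thesis .
qed

lemma comb_UNIV:
  fixes \<pi> :: "'n::finite \<Rightarrow> 'x::finite \<Rightarrow> 'n"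
  shows "comb \<pi> out p u UNIV = (\<Sum>i\<in>UNIV. u $ i)"
proof -
  have "measure (pushforward \<pi> out p i) UNIV = 1" for i
    using prob_space.prob_space[OF prob_space_pushforward, of \<pi> out p i]
    by (simp add: space_eq_UNIV_if_sets_words)
  then show ?thesis by (simp add: comb_def)
qed

lemma comb_scaleR: "comb \<pi> out p (c *\<^sub>R u) E = c * comb \<pi> out p u E"
  by (simp add: comb_def sum_distrib_left mult_ac)

lemma comb_diff: "comb \<pi> out p (u - u') E = comb \<pi> out p u E - comb \<pi> out p u' E"
  by (simp add: comb_def sum_subtractf algebra_simps)

text \<open>The redundant \<open>UNIV\<close> gives the cylinder the shape to which
  \<open>comb_shift_set\<close> applies.\<close>

lemma cylinder_singleton: "cylinder [x] = {s. shd s = x \<and> stl s \<in> UNIV}"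
  by (auto simp: set_eq_iff)

text \<open>Both sides are the total mass of the signed measure of \<open>M\<^sub>x u\<close>, which
  is its coordinate sum because each pushforward has mass 1.\<close>

lemma column_sums_inner:
  fixes \<pi> :: "'n::finite \<Rightarrow> 'x::finite \<Rightarrow> 'n"
  shows "column_sums \<pi> out p x \<bullet> u = comb \<pi> out p u (cylinder [x])"
proof -
  have U: "UNIV \<in> sets (words :: 'x stream measure)"
    using sets.top[of "words :: 'x stream measure"] by (simp add: space_stream_space)
  have "column_sums \<pi> out p x \<bullet> u = (\<Sum>i\<in>UNIV. (transfer_matrix \<pi> out p x *v u) $ i)"
    by (simp add: column_sums_def inner_vec_def matrix_vector_mult_def sum_distrib_right)
       (rule sum.swap)
  then show ?thesis unfolding cylinder_singleton comb_shift_set[OF U] comb_UNIV .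
qed

section \<open>Representing vectors and sections along words\<close>

lemma represents_cylinder:
  fixes \<pi> :: "'n::finite \<Rightarrow> 'x::finite \<Rightarrow> 'n"
  assumes "represents \<pi> out p u \<rho>"
  shows "measure \<rho> (cylinder [x]) = column_sums \<pi> out p x \<bullet> u"
  unfolding column_sums_inner using assms sstart_sets unfolding represents_def by blast

lemma represents_phi:
  fixes \<pi> :: "'n::finite \<Rightarrow> 'x::finite \<Rightarrow> 'n"
  assumes r: "represents \<pi> out p u \<rho>"
  shows "represents \<pi> out p (phi \<pi> out p x u) (msection \<rho> [x])"
proof -
  have s: "sets \<rho> = sets words" and f: "finite_measure \<rho>"
    and m: "\<And>E. E \<in> sets words \<Longrightarrow> measure \<rho> E = comb \<pi> out p u E"
    using r by (auto simp: represents_def)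
  note sec = is_section_msection[OF s f, of "[x]"]
  show ?thesis
  proof (cases "measure \<rho> (cylinder [x]) = 0")
    case True
    \<comment> \<open>The two default values agree: here \<open>phi\<close> returns 0, whose signed
      measure is zero, and the section is the null measure.\<close>
    have "finite_measure (null_measure words)" by (rule finite_measureI) simp
    then show ?thesis
      using sec True represents_cylinder[OF r, of x]
      by (simp add: is_section_def phi_def represents_def comb_def measure_def)
  next
    case False
    let ?c = "column_sums \<pi> out p x \<bullet> u"
    have c: "?c = measure \<rho> (cylinder [x])" using represents_cylinder[OF r] by simp
    have "measure (msection \<rho> [x]) E = comb \<pi> out p (phi \<pi> out p x u) E" if E: "E \<in> sets words" for E
    proof -
      \<comment> \<open>By uniqueness the section is the explicit conditional law, whose value is
        known on every event and not only on cylinders.\<close>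
      have "measure (msection \<rho> [x]) E = measure \<rho> {s \<in> cylinder [x]. sdrop (length [x]) s \<in> E} / ?c"
        using is_section_unique[OF sec explicit_section(1)[OF s f False]]
          explicit_section(2)[OF s f False E] c by simp
      also have "{s \<in> cylinder [x]. sdrop (length [x]) s \<in> E} = {s. shd s = x \<and> stl s \<in> E}"
        by auto
      also have "measure \<rho> \<dots> = comb \<pi> out p (transfer_matrix \<pi> out p x *v u) E"
        using m[OF sets_shift_set[OF E]] comb_shift_set[OF E] by simp
      finally show ?thesis using False c by (simp add: phi_def comb_scaleR)
    qed
    then show ?thesis
      using sec False by (auto simp: is_section_def represents_def prob_space.finite_measure)
  qed
qed

lemma msection_Nil:
  fixes \<mu> :: "'x::countable stream measure"
  assumes "sets \<mu> = sets words" "prob_space \<mu>"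
  shows "msection \<mu> [] = \<mu>"
proof -
  have "measure \<mu> UNIV = 1"
    using prob_space.prob_space[OF assms(2)] assms(1) by (simp add: space_eq_UNIV_if_sets_words)
  then have "is_section \<mu> [] \<mu>" using assms by (simp add: is_section_def)
  then show ?thesis
    using is_section_unique is_section_msection assms prob_space.finite_measure by blast
qed

text \<open>The two normalising factors telescope. If the cylinder of \<open>w\<close> is null, so
  is every smaller cylinder, and both sides are the null measure.\<close>

lemma msection_snoc:
  fixes \<mu> :: "'x::countable stream measure"
  assumes s: "sets \<mu> = sets words" and f: "finite_measure \<mu>"
  shows "msection (msection \<mu> w) [x] = msection \<mu> (w @ [x])"
proof (cases "measure \<mu> (cylinder w) = 0")
  case True
  have "measure \<mu> (cylinder (w @ [x])) \<le> measure \<mu> (cylinder w)"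
    using s sstart_sets by (intro finite_measure.finite_measure_mono[OF f]) (auto simp: cylinder_append)
  then have "measure \<mu> (cylinder (w @ [x])) = 0" using True by (simp add: order_antisym)
  then have 1: "msection \<mu> (w @ [x]) = null_measure words" and 2: "msection \<mu> w = null_measure words"
    using is_section_msection[OF s f, of "w @ [x]"] is_section_msection[OF s f, of w] True
    by (simp_all add: is_section_def)
  have "finite_measure (null_measure words)" by (rule finite_measureI) simp
  then have "msection (null_measure words) [x] = null_measure (words :: 'x stream measure)"
    using is_section_msection[of "null_measure words" "[x]"] by (simp add: is_section_def measure_def)
  with 1 2 show ?thesis by simp
next
  case False
  have w: "sets (msection \<mu> w) = sets words" "finite_measure (msection \<mu> w)"
    and mw: "\<And>u. measure (msection \<mu> w) (cylinder u) = measure \<mu> (cylinder (w @ u)) / measure \<mu> (cylinder w)"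
    using is_section_msection[OF s f, of w] False by (auto simp: is_section_def prob_space.finite_measure)
  have "is_section \<mu> (w @ [x]) (msection (msection \<mu> w) [x])"
    using is_section_msection[OF w, of "[x]"] False
    by (auto simp: is_section_def mw split: if_splits)
  then show ?thesis using is_section_unique is_section_msection[OF s f] by blast
qed

text \<open>Induction from the right, since \<open>fold\<close> applies the last letter last. The
  empty word uses total mass 1, which makes \<open>\<mu>\<close> its own section.\<close>

lemma represents_fold_phi:
  fixes \<pi> :: "'n::finite \<Rightarrow> 'x::finite \<Rightarrow> 'n"
  assumes "prob_space \<mu>" "represents \<pi> out p v \<mu>"
  shows "represents \<pi> out p (fold (phi \<pi> out p) w v) (msection \<mu> w)"
proof (induction w rule: rev_induct)
  case Nil
  then show ?case using assms by (simp add: msection_Nil represents_def)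
next
  case (snoc x w)
  from represents_phi[OF this, of x] show ?case
    using assms by (simp add: msection_snoc represents_def)
qed

text \<open>Represented measures are finite, so their real values on events determine them.\<close>

lemma represents_unique:
  assumes "represents \<pi> out p u \<rho>" "represents \<pi> out p u' \<rho>'"
  shows "\<rho> = \<rho>' \<longleftrightarrow> (u, u') \<in> same_measure \<pi> out p"
proof
  assume "(u, u') \<in> same_measure \<pi> out p"
  with assms show "\<rho> = \<rho>'"
    by (intro measure_eqI) (auto simp: represents_def same_measure_def finite_measure.emeasure_eq_measure)
qed (use assms in \<open>auto simp: represents_def same_measure_def\<close>)

section \<open>The orbit parametrised by words\<close>

lemma generated_semigroup_range:
  "generated_semigroup (range f) = {fold f w | w. w \<noteq> []}"
proof (intro equalityI subsetI)
  fix h assume "h \<in> generated_semigroup (range f)"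
  then show "h \<in> {fold f w | w. w \<noteq> []}"
  proof induction
    case (generator h)
    then obtain x where "h = fold f [x]" by auto
    then show ?case by blast
  next
    case (comp h h')
    \<comment> \<open>The words appear in reverse order: \<open>fold\<close> reads from the left, so
      the word of the inner map \<open>h'\<close> comes first.\<close>
    then obtain w w' where "h \<circ> h' = fold f (w' @ w)" "w' @ w \<noteq> []" by auto
    then show ?case by blast
  qed
next
  fix h assume "h \<in> {fold f w | w. w \<noteq> []}"
  then obtain w where h: "h = fold f w" and "w \<noteq> []" by auto
  from \<open>w \<noteq> []\<close> have "fold f w \<in> generated_semigroup (range f)"
  proof (induction w rule: rev_nonempty_induct)
    case (single x)
    then show ?case by (auto intro: generated_semigroup.generator)
  next
    case (snoc x w)
    have "f x \<circ> fold f w \<in> generated_semigroup (range f)"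
      by (rule generated_semigroup.comp[OF generated_semigroup.generator[OF rangeI] snoc.IH])
    moreover have "fold f (w @ [x]) = f x \<circ> fold f w" by (simp add: fun_eq_iff)
    ultimately show ?case by (simp only:)
  qed
  with h show "h \<in> generated_semigroup (range f)" by simp
qed

text \<open>Nonempty words give the semigroup; the empty word accounts for the inserted point
  \<open>v\<close>.\<close>

lemma phi_orbit_eq: "phi_orbit \<pi> out p v = range (\<lambda>w. fold (phi \<pi> out p) w v)"
proof -
  let ?F = "\<lambda>w. fold (phi \<pi> out p) w v"
  have "UNIV = insert [] {w :: 'b list. w \<noteq> []}" by auto
  then have "range ?F = insert (?F []) (?F ` {w. w \<noteq> []})" by (metis image_insert)
  also have "\<dots> = phi_orbit \<pi> out p v"
    by (auto simp: phi_orbit_def generated_semigroup_range)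
  finally show ?thesis by simp
qed

lemma phi_in_phi_orbit: "u \<in> phi_orbit \<pi> out p v \<Longrightarrow> phi \<pi> out p x u \<in> phi_orbit \<pi> out p v"
proof -
  assume "u \<in> phi_orbit \<pi> out p v"
  then obtain w where "u = fold (phi \<pi> out p) w v" by (auto simp: phi_orbit_eq)
  then have "phi \<pi> out p x u = fold (phi \<pi> out p) (w @ [x]) v" by simp
  then show ?thesis unfolding phi_orbit_eq by blast
qed

section \<open>Counting sections by classes of vectors\<close>

lemma equiv_same_measure: "equiv UNIV (same_measure \<pi> out p)"
  by (intro equivI refl_onI symI transI) (auto simp: same_measure_def)

text \<open>By linearity, two vectors with the same measure differ by a vector whose signed measure
  vanishes.\<close>

lemma same_measure_eq_Id:
  assumes "independent_pushforwards \<pi> out p"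
  shows "same_measure \<pi> out p = Id"
proof -
  have "u = u'" if "(u, u') \<in> same_measure \<pi> out p" for u u'
    using assms that unfolding independent_pushforwards_def same_measure_def
    by (auto simp: comb_diff dest!: spec[of _ "u - u'"])
  then show ?thesis by (auto simp: same_measure_def)
qed

text \<open>The hypothesis makes \<open>f\<close> factor through \<open>g\<close>;
  \<open>inv g\<close> chooses a preimage of each value of \<open>g\<close>.\<close>

lemma finite_range_if_factors:
  assumes "finite (range g)" and "\<And>a b. g a = g b \<Longrightarrow> f a = f b"
  shows "finite (range f)"
proof -
  have "f a = f (inv g (g a))" for a by (rule assms(2)) (simp add: f_inv_into_f)
  then have "range f \<subseteq> (\<lambda>b. f (inv g b)) ` range g" by blast
  then show ?thesis using assms(1) finite_surj by blast
qed

text \<open>Sections and classes of orbit points are both indexed by words, and two words give equal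
  sections exactly when they give equal classes. Hence either range is finite if the other
  is.\<close>

lemma finite_state_iff:
  fixes \<pi> :: "'n::finite \<Rightarrow> 'x::finite \<Rightarrow> 'n"
  assumes "prob_space \<mu>" "represents \<pi> out p v \<mu>"
  shows "finite_state \<mu> \<longleftrightarrow> finite (phi_orbit \<pi> out p v // same_measure \<pi> out p)"
proof -
  let ?S = "same_measure \<pi> out p" and ?u = "\<lambda>w. fold (phi \<pi> out p) w v"
  have eq: "msection \<mu> w = msection \<mu> w' \<longleftrightarrow> ?S `` {?u w} = ?S `` {?u w'}" for w w'
    unfolding represents_unique[OF represents_fold_phi[OF assms] represents_fold_phi[OF assms]]
    by (rule eq_equiv_class_iff[OF equiv_same_measure, symmetric]) auto
  have "finite_state \<mu> \<longleftrightarrow> finite (range (\<lambda>w. ?S `` {?u w}))"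
    unfolding finite_state_def by (rule iffI; erule finite_range_if_factors) (simp_all only: eq)
  also have "range (\<lambda>w. ?S `` {?u w}) = phi_orbit \<pi> out p v // ?S"
    by (auto simp: quotient_def phi_orbit_eq)
  finally show ?thesis .
qed

text \<open>The transition and weight conditions hold for every vector that represents a measure;
  the orbit supplies closure and guarantees that each state represents some section of
  \<open>\<mu>\<close>.\<close>

lemma computes_phi_orbit:
  fixes \<pi> :: "'n::finite \<Rightarrow> 'x::finite \<Rightarrow> 'n"
  assumes "prob_space \<mu>" "represents \<pi> out p v \<mu>"
  shows "computes \<lparr>states = phi_orbit \<pi> out p v, initial = v, trans = \<lambda>u x. phi \<pi> out p x u,
      weight = \<lambda>u x. column_sums \<pi> out p x \<bullet> u\<rparr> (represents \<pi> out p) \<mu>"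
proof -
  have "\<exists>w. represents \<pi> out p u (msection \<mu> w)" if "u \<in> phi_orbit \<pi> out p v" for u
    using that represents_fold_phi[OF assms] by (auto simp: phi_orbit_eq)
  moreover have "v \<in> phi_orbit \<pi> out p v" by (simp add: phi_orbit_def)
  ultimately show ?thesis
    unfolding computes_def using assms
    by (simp add: phi_in_phi_orbit represents_phi represents_cylinder)
qed

theorem corollary8p12:
  fixes \<pi> :: "'n::finite \<Rightarrow> 'x::finite \<Rightarrow> 'n" and out :: "'n \<Rightarrow> 'x \<Rightarrow> 'x"
    and p :: "'x pmf" and v :: "real ^ 'n" and \<mu> :: "'x stream measure"
  assumes "prob_space \<mu>" and "represents \<pi> out p v \<mu>"
  shows "(finite (phi_orbit \<pi> out p v) \<longrightarrow> finite_state \<mu>) \<and>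
    (finite_state \<mu> \<longleftrightarrow> finite (phi_orbit \<pi> out p v // same_measure \<pi> out p)) \<and>
    (independent_pushforwards \<pi> out p \<longrightarrow>
       (finite_state \<mu> \<longleftrightarrow> finite (phi_orbit \<pi> out p v))) \<and>
    (\<exists>A. states A = phi_orbit \<pi> out p v \<and> initial A = v \<and>
       transition_diagram A = action_graph \<pi> out p v \<and>
       computes A (represents \<pi> out p) \<mu>)"
proof (intro conjI impI)
  let ?O = "phi_orbit \<pi> out p v"
  note iff = finite_state_iff[OF assms]
  show "finite_state \<mu> \<longleftrightarrow> finite (?O // same_measure \<pi> out p)" by (rule iff)
  show "finite_state \<mu>" if "finite ?O"
    using that unfolding iff by (simp add: quotient_def)
  show "finite_state \<mu> \<longleftrightarrow> finite ?O" if "independent_pushforwards \<pi> out p"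
  proof -
    \<comment> \<open>All classes are singletons, and \<open>u\<close> is recovered from
      \<open>{u}\<close>, so the quotient is finite exactly when the orbit is.\<close>
    have "?O // same_measure \<pi> out p = (\<lambda>u. {u}) ` ?O"
      by (auto simp: same_measure_eq_Id[OF that] quotient_def)
    then show ?thesis unfolding iff by (simp add: finite_image_iff)
  qed
  show "\<exists>A. states A = ?O \<and> initial A = v \<and>
       transition_diagram A = action_graph \<pi> out p v \<and> computes A (represents \<pi> out p) \<mu>"
    \<comment> \<open>The fourth conjunct is resolved first because it fixes the witness
      automaton.\<close>
    by (rule exI, intro conjI, rule_tac [4] computes_phi_orbit[OF assms])
       (auto simp: transition_diagram_def action_graph_def)
qed

end
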